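(* Let $m\geq 3$ and let $G=S(2,1^{m-1})$, i.e. the tree on the $m+2$ vertices $o,x_1,\dots,x_m,y$ whose edges are $ox_1,\dots,ox_m$ and $x_1y$. Let $H$ be a distance-balanced graph containing $G$ as a spanning subgraph. Then $\mathrm{diam}(H)\leq 2$, and hence $H$ is $r$-regular for some integer $r$ with $m\leq r\leq m+1$.
   Context: All graphs are finite and simple. For vertices $u,v$ of a graph $H$, $d_H(u,v)$ is the length of a shortest $u$–$v$ path, and $\mathrm{diam}(H)=\max_{u,v} d_H(u,v)$. For an edge $xy$ of $H$, $W^H_{xy}=\{u\in V(H): d_H(u,x)<d_H(u,y)\}$. A graph $H$ is distance-balanced if $|W^H_{xy}|=|W^H_{yx}|$ for every edge $xy$ of $H$. A starlike tree is a tree with exactly one vertex of degree greater than two; $S(n_1^{\alpha_1},\dots,n_k^{\alpha_k})$ denotes the starlike tree in which deleting the central vertex leaves $\alpha_i$ paths with $n_i$ vertices for each $i$. *)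

theory Defs
  imports "Graph_Theory.Graph_Theory"
begin

text \<open>
  A finite simple graph is a \<^locale>\<open>pair_graph\<close>: a finite, loopless, symmetric digraph
  whose arcs are pairs of vertices, each edge \<open>uv\<close> being represented by the two arcs \<open>(u, v)\<close>
  and \<open>(v, u)\<close>.
\<close>

definition gdist :: "('a, 'b) pre_digraph \<Rightarrow> 'a \<Rightarrow> 'a \<Rightarrow> ereal" where
  "gdist H u v = wf_digraph.\<mu> H (\<lambda>_. 1) u v"

text \<open>
  The library's \<open>\<mu>\<close> is an infimum over all walks, and infinite if there is none; with
  unit weights it is the length of a shortest path.
\<close>

lemma (in wf_digraph) gdist_eq_shortest_path:
  "gdist G u v = (INF p\<in>{p. apath u p v}. ereal (real (length p)))"
proof -
  have cost: "awalk_cost (\<lambda>_. 1) p = real (length p)" for p :: "'b awalk"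
    by (induct p) (auto simp: awalk_cost_def)
  show ?thesis
    unfolding gdist_def \<mu>_def cost
  proof (rule antisym)
    show "(INF p\<in>{p. awalk u p v}. ereal (real (length p)))
        \<le> (INF p\<in>{p. apath u p v}. ereal (real (length p)))"
      by (rule INF_superset_mono) (auto simp: apath_def)
  next
    show "(INF p\<in>{p. apath u p v}. ereal (real (length p)))
        \<le> (INF p\<in>{p. awalk u p v}. ereal (real (length p)))"
    proof (rule INF_mono)
      fix p assume "p \<in> {p. awalk u p v}"
      then have w: "awalk u p v" by simp
      have "apath u (awalk_to_apath p) v"
        using w by (rule apath_awalk_to_apath)
      moreover have "length (awalk_to_apath p) \<le> length p"
        using w
      proof (induct rule: awalk_to_apath_induct)
        case (path p)
        then have "awalk_to_apath p = p"
          by (auto simp: awalk_to_apath.simps)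
        then show ?case by simp
      next
        case (decomp p q r s)
        have "p = q @ r @ s"
          using decomp by (auto elim: awalk_cyc_decompE)
        then show ?case
          using decomp step_awalk_to_apath[of u p v q r s] by simp
      qed
      ultimately show "\<exists>q\<in>{p. apath u p v}. ereal (real (length q)) \<le> ereal (real (length p))"
        by auto
    qed
  qed
qed

definition diam :: "('a, 'b) pre_digraph \<Rightarrow> ereal" where
  "diam H = (SUP (u, v)\<in>verts H \<times> verts H. gdist H u v)"

definition closer :: "('a, 'b) pre_digraph \<Rightarrow> 'a \<Rightarrow> 'a \<Rightarrow> 'a set" where
  "closer H x y = {u \<in> verts H. gdist H u x < gdist H u y}"

definition distance_balanced :: "('a, 'b) pre_digraph \<Rightarrow> bool" where
  "distance_balanced H \<longleftrightarrow>
    (\<forall>(x, y)\<in>arcs_ends H. card (closer H x y) = card (closer H y x))"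

text \<open>In a symmetric digraph without parallel arcs, the out-degree is the degree of the graph.\<close>

definition regular :: "('a, 'b) pre_digraph \<Rightarrow> nat \<Rightarrow> bool" where
  "regular H r \<longleftrightarrow> (\<forall>v\<in>verts H. out_degree H v = r)"

text \<open>
  The starlike tree \<open>S(2, 1\<^sup>m\<^sup>-\<^sup>1)\<close> with centre \<open>c\<close>, neighbours \<open>x 1, \<dots>, x m\<close> of the centre,
  and the leaf \<open>y\<close> attached to \<open>x 1\<close>; the predicate on the labels says that these
  are \<open>m + 2\<close> distinct vertices.
\<close>

definition starlike_labels :: "nat \<Rightarrow> 'a \<Rightarrow> (nat \<Rightarrow> 'a) \<Rightarrow> 'a \<Rightarrow> bool" where
  "starlike_labels m c x y \<longleftrightarrow>
    inj_on x {1..m} \<and> c \<notin> x ` {1..m} \<and> y \<notin> x ` {1..m} \<and> c \<noteq> y"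

definition starlike_2_1 :: "nat \<Rightarrow> 'a \<Rightarrow> (nat \<Rightarrow> 'a) \<Rightarrow> 'a \<Rightarrow> 'a pair_pre_digraph" where
  "starlike_2_1 m c x y =
    \<lparr> pverts = {c, y} \<union> x ` {1..m},
      parcs = (\<Union>i\<in>{1..m}. {(c, x i), (x i, c)}) \<union> {(x 1, y), (y, x 1)} \<rparr>"

end

theory Submission
  imports Defs
begin

text \<open>
  The centre \<open>c\<close> is adjacent to every vertex except possibly \<open>y\<close>. If some \<open>d\<close> were at distance
  greater than two from \<open>y\<close>, then \<open>d\<close> would be the only vertex closer to \<open>d\<close> than to \<open>c\<close>,
  whereas both \<open>c\<close> and \<open>y\<close> are closer to \<open>c\<close> than to \<open>d\<close>, so the edge \<open>cd\<close> would not be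
  balanced. In diameter at most two, the vertices closer to \<open>u\<close> than to an adjacent \<open>v\<close> are \<open>u\<close>
  and the neighbours of \<open>u\<close> other than \<open>v\<close> that are not neighbours of \<open>v\<close>; hence balanced edges
  have ends of equal degree.
\<close>

text \<open>With unit weights the cost of a walk is its length. Exhibiting one walk then bounds the
  distance from above, and bounding the length of every walk bounds it from below.\<close>

lemma (in wf_digraph) gdist_eq: "gdist G u v = (INF p\<in>{p. awalk u p v}. ereal (real (length p)))"
proof -
  have "awalk_cost (\<lambda>_. 1) p = real (length p)" for p :: "'b awalk"
    by (induct p) (auto simp: awalk_cost_def)
  then show ?thesis
    by (simp add: gdist_def \<mu>_def)
qed

lemma (in wf_digraph) gdist_le_length: "awalk u p v \<Longrightarrow> gdist G u v \<le> ereal (real (length p))"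
  unfolding gdist_eq by (rule INF_lower) simp

lemma (in wf_digraph) gdist_nonneg: "0 \<le> gdist G u v"
  unfolding gdist_eq by (rule INF_greatest) simp

lemma length_rev_path [simp]: "length (rev_path p) = length p"
  by (induct p) auto

text \<open>Reversing a walk preserves its length; the inequality obtained this way is used in both
  directions.\<close>

lemma (in pair_sym_digraph) gdist_commute: "gdist (with_proj G) u v = gdist (with_proj G) v u"
proof -
  have "gdist (with_proj G) u v \<le> gdist (with_proj G) v u" for u v
    unfolding gdist_eq
  proof (rule INF_mono)
    fix p assume "p \<in> {p. awalk v p u}"
    then show "\<exists>q\<in>{p. awalk u p v}. ereal (real (length q)) \<le> ereal (real (length p))"
      by (intro bexI[of _ "rev_path p"]) auto
  qed
  then show ?thesis
    by (intro antisym)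
qed

context pair_wf_digraph
begin

lemma gdist_self: "u \<in> pverts G \<Longrightarrow> gdist (with_proj G) u u = 0"
  using gdist_le_length[of u "[]" u] gdist_nonneg[of u u]
  by (simp add: awalk_Nil_iff flip: zero_ereal_def)

lemma gdist_ge_1:
  assumes "u \<noteq> v"
  shows "1 \<le> gdist (with_proj G) u v"
  unfolding gdist_eq
proof (rule INF_greatest)
  fix p assume "p \<in> {p. awalk u p v}"
  with assms show "1 \<le> ereal (real (length p))"
    by (cases p) (auto simp: awalk_Nil_iff)
qed

lemma gdist_ge_2:
  assumes "u \<noteq> v" "(u, v) \<notin> parcs G"
  shows "2 \<le> gdist (with_proj G) u v"
  unfolding gdist_eq
proof (rule INF_greatest)
  fix p assume "p \<in> {p. awalk u p v}"
  with assms show "2 \<le> ereal (real (length p))"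
    by (cases p rule: list_exhaust_NSC) (auto simp: awalk_Nil_iff awalk_Cons_iff)
qed

lemma gdist_le_1: "(u, v) \<in> parcs G \<Longrightarrow> gdist (with_proj G) u v \<le> 1"
  using gdist_le_length[of u "[(u, v)]" v]
  by (auto simp: awalk_Nil_iff awalk_Cons_iff one_ereal_def dest: wellformed')

lemma gdist_le_2: "(u, w) \<in> parcs G \<Longrightarrow> (w, v) \<in> parcs G \<Longrightarrow> gdist (with_proj G) u v \<le> 2"
  using gdist_le_length[of u "[(u, w), (w, v)]" v]
  by (auto simp: awalk_Nil_iff awalk_Cons_iff dest: wellformed')

lemma out_degree_eq_card_nbrs: "out_degree (with_proj G) u = card {v. (u, v) \<in> parcs G}"
proof -
  have "out_arcs (with_proj G) u = Pair u ` {v. (u, v) \<in> parcs G}"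
    by auto
  then show ?thesis
    unfolding out_degree_def by (simp add: card_image inj_on_def)
qed

lemma diam_le_iff:
  "diam (with_proj G) \<le> k \<longleftrightarrow> (\<forall>u\<in>pverts G. \<forall>v\<in>pverts G. gdist (with_proj G) u v \<le> k)"
  unfolding diam_def by (auto simp: SUP_le_iff)

end

lemma (in pair_fin_digraph) finite_nbrs: "finite {v. (u, v) \<in> parcs G}"
  by (rule finite_subset[OF _ pair_finite_verts]) (auto dest: wellformed')

context pair_graph
begin

text \<open>Distances between distinct vertices are 1 or 2 here, so they are decided by adjacency.
  The vertex \<open>v\<close> is removed explicitly because it is a neighbour of \<open>u\<close>
  and, without loops, not of itself.\<close>

lemma closer_diam_2:
  assumes "diam (with_proj G) \<le> 2" and uv: "(u, v) \<in> parcs G"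
  shows "closer (with_proj G) u v = insert u ({w. (u, w) \<in> parcs G} - {w. (v, w) \<in> parcs G} - {v})"
    (is "_ = ?R")
proof -
  have le: "gdist (with_proj G) a b \<le> 2" if "a \<in> pverts G" "b \<in> pverts G" for a b
    using assms(1) that by (simp add: diam_le_iff)
  have "u \<noteq> v" and V: "u \<in> pverts G" "v \<in> pverts G"
    using uv by (auto dest: no_loops' wellformed')
  have "gdist (with_proj G) w u < gdist (with_proj G) w v \<longleftrightarrow> w \<in> ?R" if w: "w \<in> pverts G" for w
  proof -
    consider "w = u" | "w = v" | "w \<noteq> u" "w \<noteq> v" by blast
    then show ?thesis
    proof cases
      case 1
      then show ?thesis
        using gdist_self[OF V(1)] gdist_ge_1[OF \<open>u \<noteq> v\<close>] by (auto intro: less_le_trans[of _ 1])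
    next
      case 2
      then show ?thesis
        using gdist_self[OF V(2)] gdist_nonneg[of v u] \<open>u \<noteq> v\<close> by simp
    next
      case 3
      have dist: "gdist (with_proj G) w a = (if (a, w) \<in> parcs G then 1 else 2)"
        if "w \<noteq> a" "a \<in> pverts G" for a
        using gdist_ge_1[OF that(1)] gdist_ge_2[OF that(1)] gdist_le_1[of w a] le[OF w that(2)]
          arcs_symmetric[of w a] arcs_symmetric[of a w]
        by (metis antisym)
      show ?thesis
        using 3 V by (auto simp: dist)
    qed
  qed
  moreover have "?R \<subseteq> pverts G"
    using uv by (auto dest: wellformed')
  ultimately show ?thesis
    unfolding closer_def by auto
qed

lemma out_degree_eq_if_balanced:
  assumes "distance_balanced (with_proj G)" "diam (with_proj G) \<le> 2" and uv: "(u, v) \<in> parcs G"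
  shows "out_degree (with_proj G) u = out_degree (with_proj G) v"
proof -
  let ?N = "\<lambda>u. {w. (u, w) \<in> parcs G}"
  \<comment> \<open>Relative to \<open>?N a - ?N b\<close>, the set \<open>closer\<close> loses
    \<open>b\<close> and gains \<open>a\<close>, so the cardinality is unchanged.\<close>
  have closer: "card (closer (with_proj G) a b) = card (?N a - ?N b)" if ab: "(a, b) \<in> parcs G" for a b
  proof -
    have "b \<in> ?N a - ?N b" "a \<notin> ?N a"
      using ab by (auto dest: no_loops')
    then show ?thesis
      unfolding closer_diam_2[OF assms(2) ab]
      using finite_nbrs[of a] card.remove[of "?N a - ?N b" b] by simp
  qed
  have "card (closer (with_proj G) u v) = card (closer (with_proj G) v u)"
    using assms(1) uv by (auto simp: distance_balanced_def)
  then have "card (?N u - ?N v) = card (?N v - ?N u)"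
    using closer uv arcs_symmetric by metis
  \<comment> \<open>The common neighbours contribute equally to both degrees.\<close>
  moreover have "card (?N a) = card (?N a - ?N b) + card (?N a \<inter> ?N b)" for a b
    using card_Int_Diff[OF finite_nbrs[of a], of "?N b"] by simp
  ultimately show ?thesis
    unfolding out_degree_eq_card_nbrs by (metis Int_commute)
qed

text \<open>Two vertices other than \<open>c\<close> and \<open>y\<close> have the common neighbour
  \<open>c\<close>, so the balance condition is needed only to control distances from
  \<open>y\<close>.\<close>

lemma diam_le_2_if_balanced:
  assumes bal: "distance_balanced (with_proj G)"
    and c: "\<And>v. v \<in> pverts G \<Longrightarrow> v \<noteq> c \<Longrightarrow> v \<noteq> y \<Longrightarrow> (c, v) \<in> parcs G"
    and V: "c \<in> pverts G" "y \<in> pverts G"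
    and yc: "y \<noteq> c" "gdist (with_proj G) y c \<le> 2"
  shows "diam (with_proj G) \<le> 2"
proof -
  have y: "gdist (with_proj G) y d \<le> 2" if d: "d \<in> pverts G" for d
  proof (rule ccontr)
    assume far: "\<not> gdist (with_proj G) y d \<le> 2"
    then have "d \<noteq> c" "d \<noteq> y"
      using yc(2) gdist_self[OF V(2)] by auto
    then have cd: "(c, d) \<in> parcs G"
      using c d by blast
    \<comment> \<open>A vertex other than \<open>c\<close> and \<open>y\<close> is within distance 1
      of \<open>c\<close>, so it can be closer to \<open>d\<close> only at distance 0. The vertex
      \<open>y\<close> is excluded by \<open>far\<close> and \<open>yc\<close>.\<close>
    have "closer (with_proj G) d c \<subseteq> {d}"
    proof
      fix w assume "w \<in> closer (with_proj G) d c"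
      then have w: "w \<in> pverts G" and less: "gdist (with_proj G) w d < gdist (with_proj G) w c"
        by (auto simp: closer_def)
      have "w \<noteq> y"
        using less far yc(2) by auto
      moreover have "w \<noteq> c"
        using less gdist_self[OF V(1)] gdist_nonneg[of c d] by auto
      ultimately have "gdist (with_proj G) w c \<le> 1"
        using c w by (auto intro: gdist_le_1 arcs_symmetric)
      then show "w \<in> {d}"
        using less gdist_ge_1[of w d] by (metis leD order_trans singletonI)
    qed
    then have "card (closer (with_proj G) d c) \<le> 1"
      using card_mono[of "{d}"] by fastforce
    \<comment> \<open>Here \<open>y\<close> belongs because its distance to \<open>c\<close> is at
      most 2 while its distance to \<open>d\<close> exceeds 2.\<close>
    moreover have "{c, y} \<subseteq> closer (with_proj G) c d"
      using V far yc(2) gdist_self[OF V(1)] gdist_ge_1[of c d] \<open>d \<noteq> c\<close>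
      by (auto simp: closer_def intro: less_le_trans[of _ 1])
    then have "card {c, y} \<le> card (closer (with_proj G) c d)"
      by (rule card_mono[rotated]) (simp add: closer_def pair_finite_verts)
    moreover have "card (closer (with_proj G) c d) = card (closer (with_proj G) d c)"
      using bal cd by (auto simp: distance_balanced_def)
    ultimately show False
      using yc(1) by simp
  qed
  have "gdist (with_proj G) u v \<le> 2" if uv: "u \<in> pverts G" "v \<in> pverts G" for u v
  proof (cases "u = y \<or> v = y")
    case True
    then show ?thesis
      using y uv gdist_commute by metis
  next
    case False
    have "(1::ereal) \<le> 2" by simp
    show ?thesis
    proof (cases "u = c \<or> v = c")
      case True
      then have "u = v \<or> (u, v) \<in> parcs G"
        using False c uv arcs_symmetric by blast
      then show ?thesis
        using gdist_self[OF uv(1)] gdist_le_1[of u v] order_trans[OF _ \<open>1 \<le> 2\<close>] by auto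
    next
      case c': False
      then show ?thesis
        using False c uv by (intro gdist_le_2[of u c v]) (auto intro: arcs_symmetric)
    qed
  qed
  then show ?thesis
    by (simp add: diam_le_iff)
qed

end

theorem theorem3p2:
  fixes m :: nat and c y :: 'a and x :: "nat \<Rightarrow> 'a" and H :: "'a pair_pre_digraph"
  assumes "m \<ge> 3"
    and "starlike_labels m c x y"
    and "pair_graph H"
    and "distance_balanced (with_proj H)"
    and "spanning (with_proj (starlike_2_1 m c x y)) (with_proj H)"
  shows "diam (with_proj H) \<le> 2 \<and>
    (\<exists>r. m \<le> r \<and> r \<le> m + 1 \<and> regular (with_proj H) r)"
proof -
  interpret pair_graph H by fact
  have "c \<noteq> y" and inj: "inj_on x {1..m}" and y: "y \<notin> x ` {1..m}"
    using assms(2) by (auto simp: starlike_labels_def)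
  have card_x: "card (x ` {1..m}) = m"
    using card_image[OF inj] by simp
  have verts: "pverts H = {c, y} \<union> x ` {1..m}"
    using assms(5) by (auto simp: spanning_def starlike_2_1_def)
  have sub: "parcs (starlike_2_1 m c x y) \<subseteq> parcs H"
    using assms(5) by (auto simp: spanning_def subgraph_def)
  have cx: "(c, x i) \<in> parcs H" if "i \<in> {1..m}" for i
    by (rule subsetD[OF sub]) (use that in \<open>auto simp: starlike_2_1_def\<close>)
  have x1y: "(x 1, y) \<in> parcs H"
    using sub by (auto simp: starlike_2_1_def)
  have cx1: "(c, x 1) \<in> parcs H"
    using cx assms(1) by simp
  \<comment> \<open>The walk runs from \<open>y\<close> through \<open>x 1\<close> to
    \<open>c\<close>.\<close>
  have yc: "gdist (with_proj H) y c \<le> 2"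
    using gdist_le_2 x1y cx1 arcs_symmetric by blast
  have cv: "(c, v) \<in> parcs H" if "v \<in> pverts H" "v \<noteq> c" "v \<noteq> y" for v
    using that verts cx by blast
  have V: "c \<in> pverts H" "y \<in> pverts H" and "y \<noteq> c"
    using verts \<open>c \<noteq> y\<close> by auto
  have diam: "diam (with_proj H) \<le> 2"
    using assms(4) cv V \<open>y \<noteq> c\<close> yc by (rule diam_le_2_if_balanced)
  have deg: "out_degree (with_proj H) u = out_degree (with_proj H) v" if "(u, v) \<in> parcs H" for u v
    using assms(4) diam that by (rule out_degree_eq_if_balanced)
  \<comment> \<open>Equality of degrees spreads from \<open>c\<close> along the tree edges: directly
    to each \<open>x i\<close>, and through \<open>x 1\<close> to \<open>y\<close>.\<close>
  have "out_degree (with_proj H) v = out_degree (with_proj H) c" if v: "v \<in> pverts H" for v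
  proof -
    consider "v = c" | "v = y" | i where "i \<in> {1..m}" "v = x i"
      using v verts by auto
    then show ?thesis
    proof cases
      case 1
      then show ?thesis by simp
    next
      case 2
      then show ?thesis
        using deg[OF cx1] deg[OF x1y] by metis
    next
      case 3
      then show ?thesis
        using deg[OF cx[OF 3(1)]] by metis
    qed
  qed
  then have "regular (with_proj H) (out_degree (with_proj H) c)"
    by (simp add: regular_def)
  moreover have "m \<le> out_degree (with_proj H) c"
  proof -
    have "card (x ` {1..m}) \<le> card {v. (c, v) \<in> parcs H}"
      by (rule card_mono[OF finite_nbrs]) (use cx in blast)
    then show ?thesis
      using card_x by (simp add: out_degree_eq_card_nbrs)
  qed
  \<comment> \<open>Only \<open>y\<close> can be a neighbour of \<open>c\<close> besides the
    \<open>x i\<close>; this is the gap between \<open>m\<close> and \<open>m + 1\<close>.\<close>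
  moreover have "out_degree (with_proj H) c \<le> m + 1"
  proof -
    have "{v. (c, v) \<in> parcs H} \<subseteq> insert y (x ` {1..m})"
      using verts by (auto dest: no_loops' in_arcsD2)
    then have "card {v. (c, v) \<in> parcs H} \<le> card (insert y (x ` {1..m}))"
      by (rule card_mono[rotated]) simp
    also have "\<dots> = m + 1"
      using y card_x by simp
    finally show ?thesis
      by (simp add: out_degree_eq_card_nbrs)
  qed
  ultimately show ?thesis
    using diam by blast
qed

end
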